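(* Let $k\ge1$, let $f_k\in\mathbb{V}_k^*=L^2(0,T)$ and let $u_k\in\mathbb{U}_k$ be the solution of $\frac{1}{c^2}u_k''+\lambda_ku_k=f_k$ in $(0,T)$. Then $$\|u_k\|_{\mathbb{U}_k}^2+\frac{1}{c^2}\|u_k'\|_{L^2(0,T)}^2\eqsim\frac{1}{\lambda_k}\|f_k\|_{L^2(0,T)}^2+c^2\left(\|f_k^{\mathtt{c}}\|_{L^2(0,T)}^2+\|f_k^{\mathtt{s}}\|_{L^2(0,T)}^2\right),$$ with hidden constants independent of $\lambda_k$, $c$ and $T$.
   Context: $T>0$ is the time horizon and $c>0$ the wave speed. $\Omega\subset\mathbb{R}^d$, $d\ge 1$, is an open, bounded, connected set with Lipschitz boundary, and $0<\lambda_1\le\lambda_2\le\dots\to+\infty$ are the eigenvalues of the Dirichlet Laplacian $-\Delta:H^1_0(\Omega)\to H^{-1}(\Omega)$. Set $\mu_k:=c^2\lambda_k$. $\mathbb{U}_k:=\{w\in H^2(0,T)\mid w(0)=0=w'(0)\}$ is equipped with $\|w\|_{\mathbb{U}_k}^2:=\lambda_k\|w\|_{L^2(0,T)}^2+\frac{1}{c^4\lambda_k}\|w''\|_{L^2(0,T)}^2$. For $f_k\in L^2(0,T)$ the functions $f_k^{\mathtt{c}},f_k^{\mathtt{s}}\in H^1(0,T)$ are $$f_k^{\mathtt{c}}(t):=\int_0^tf_k(s)\cos(\sqrt{\mu_k}\,s)\,\mathrm{d}s,\qquad f_k^{\mathtt{s}}(t):=\int_0^tf_k(s)\sin(\sqrt{\mu_k}\,s)\,\mathrm{d}s.$$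 $x\eqsim y$ means that there are constants $0<C_1\le C_2$ (the hidden constants, which also do not depend on $f_k$ and $u_k$) such that $C_1x\le y\le C_2x$. *)

theory Defs
  imports "HOL-Analysis.Analysis"
begin

text \<open>Elements of the function spaces below are total functions; only their values on the
  set \<open>S\<close>, up to null sets, matter.\<close>

definition L2 :: "'a::euclidean_space set \<Rightarrow> ('a \<Rightarrow> real) set" where
  "L2 S = {f. f \<in> borel_measurable (lebesgue_on S) \<and> integrable (lebesgue_on S) (\<lambda>x. (f x)\<^sup>2)}"

definition L2_inner :: "'a::euclidean_space set \<Rightarrow> ('a \<Rightarrow> real) \<Rightarrow> ('a \<Rightarrow> real) \<Rightarrow> real" where
  "L2_inner S f g = (\<integral>x. f x * g x \<partial>lebesgue_on S)"

definition L2_norm :: "'a::euclidean_space set \<Rightarrow> ('a \<Rightarrow> real) \<Rightarrow> real" where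
  "L2_norm S f = sqrt (L2_inner S f f)"

definition locally_integrable :: "'a::euclidean_space set \<Rightarrow> ('a \<Rightarrow> real) \<Rightarrow> bool" where
  "locally_integrable S f \<longleftrightarrow> (\<forall>K. compact K \<and> K \<subseteq> S \<longrightarrow> integrable (lebesgue_on K) f)"

primrec cont_diff :: "nat \<Rightarrow> ('a::euclidean_space \<Rightarrow> real) \<Rightarrow> bool" where
  "cont_diff 0 f \<longleftrightarrow> continuous_on UNIV f"
| "cont_diff (Suc n) f \<longleftrightarrow> (\<forall>x. f differentiable at x) \<and>
     (\<forall>b\<in>Basis. cont_diff n (\<lambda>x. frechet_derivative f (at x) b))"

definition test_functions :: "'a::euclidean_space set \<Rightarrow> ('a \<Rightarrow> real) set" where
  "test_functions S = {\<phi>. (\<forall>n. cont_diff n \<phi>) \<and> (\<exists>K. compact K \<and> K \<subseteq> S \<and> (\<forall>x. x \<notin> K \<longrightarrow> \<phi> x = 0))}"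

definition has_weak_partial ::
  "'a::euclidean_space set \<Rightarrow> 'a \<Rightarrow> ('a \<Rightarrow> real) \<Rightarrow> ('a \<Rightarrow> real) \<Rightarrow> bool" where
  "has_weak_partial S b u v \<longleftrightarrow> locally_integrable S u \<and> locally_integrable S v \<and>
     (\<forall>\<phi>\<in>test_functions S.
        L2_inner S u (\<lambda>x. frechet_derivative \<phi> (at x) b) = - L2_inner S v \<phi>)"

text \<open>Weak derivatives on open sets are unique up to null sets; \<open>weak_partial\<close> selects one of
  them, and is only meaningful if one exists.\<close>

definition weak_partial :: "'a::euclidean_space set \<Rightarrow> 'a \<Rightarrow> ('a \<Rightarrow> real) \<Rightarrow> 'a \<Rightarrow> real" where
  "weak_partial S b u = (SOME v. has_weak_partial S b u v)"

definition H1 :: "'a::euclidean_space set \<Rightarrow> ('a \<Rightarrow> real) set" where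
  "H1 S = {u \<in> L2 S. \<forall>b\<in>Basis. \<exists>v\<in>L2 S. has_weak_partial S b u v}"

definition H2 :: "'a::euclidean_space set \<Rightarrow> ('a \<Rightarrow> real) set" where
  "H2 S = {u \<in> H1 S. \<forall>b\<in>Basis. weak_partial S b u \<in> H1 S}"

definition H1_norm :: "'a::euclidean_space set \<Rightarrow> ('a \<Rightarrow> real) \<Rightarrow> real" where
  "H1_norm S u = sqrt ((L2_norm S u)\<^sup>2 + (\<Sum>b\<in>Basis. (L2_norm S (weak_partial S b u))\<^sup>2))"

definition H1_0 :: "'a::euclidean_space set \<Rightarrow> ('a \<Rightarrow> real) set" where
  "H1_0 S = {u \<in> H1 S. \<exists>\<phi>. (\<forall>n::nat. \<phi> n \<in> test_functions S) \<and>
     (\<lambda>n. H1_norm S (\<lambda>x. u x - \<phi> n x)) \<longlonglongrightarrow> 0}"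


text \<open>Near each boundary point, and up to a rotation taking \<open>\<nu>\<close> to the last coordinate axis,
  the domain is the part lying below the graph of a Lipschitz function on the hyperplane
  orthogonal to \<open>\<nu>\<close>.\<close>

definition lipschitz_boundary :: "'a::euclidean_space set \<Rightarrow> bool" where
  "lipschitz_boundary \<Omega> \<longleftrightarrow> (\<forall>x\<in>frontier \<Omega>. \<exists>\<nu> r L g.
     norm \<nu> = 1 \<and> r > 0 \<and> L-lipschitz_on {y. y \<bullet> \<nu> = 0} g \<and>
     \<Omega> \<inter> ball x r = {y \<in> ball x r. y \<bullet> \<nu> < g (y - (y \<bullet> \<nu>) *\<^sub>R \<nu>)})"

definition lipschitz_domain :: "'a::euclidean_space set \<Rightarrow> bool" where
  "lipschitz_domain \<Omega> \<longleftrightarrow> open \<Omega> \<and> bounded \<Omega> \<and> connected \<Omega> \<and> lipschitz_boundary \<Omega>"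

text \<open>\<open>e\<close> is a nonzero element of \<open>H1_0 \<Omega>\<close> with \<open>-\<Delta> e = \<mu> e\<close> in the dual space: the operator
  \<open>-\<Delta>\<close> maps \<open>e\<close> to the functional taking \<open>v\<close> to the integral of \<open>\<nabla>e \<bullet> \<nabla>v\<close>.\<close>

definition dirichlet_eigenpair :: "'a::euclidean_space set \<Rightarrow> real \<Rightarrow> ('a \<Rightarrow> real) \<Rightarrow> bool" where
  "dirichlet_eigenpair \<Omega> \<mu> e \<longleftrightarrow> e \<in> H1_0 \<Omega> \<and> \<not> (AE x in lebesgue_on \<Omega>. e x = 0) \<and>
     (\<forall>v\<in>H1_0 \<Omega>. (\<Sum>b\<in>Basis. L2_inner \<Omega> (weak_partial \<Omega> b e) (weak_partial \<Omega> b v))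
        = \<mu> * L2_inner \<Omega> e v)"

text \<open>\<open>lam 1, lam 2, \<dots>\<close> (the value \<open>lam 0\<close> is irrelevant) enumerates the eigenvalues in increasing
  order, each repeated according to its multiplicity: there is an orthonormal system of
  eigenfunctions \<open>e k\<close> for \<open>lam k\<close> that is maximal, i.e.\ no eigenfunction is orthogonal to all of
  it.\<close>

definition dirichlet_eigenvalues :: "'a::euclidean_space set \<Rightarrow> (nat \<Rightarrow> real) \<Rightarrow> bool" where
  "dirichlet_eigenvalues \<Omega> lam \<longleftrightarrow>
     0 < lam 1 \<and> mono_on {1..} lam \<and> filterlim lam at_top sequentially \<and>
     (\<exists>e. (\<forall>k\<ge>1. dirichlet_eigenpair \<Omega> (lam k) (e k)) \<and>
          (\<forall>j\<ge>1. \<forall>k\<ge>1. L2_inner \<Omega> (e j) (e k) = (if j = k then 1 else 0)) \<and>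
          (\<forall>\<mu> v. dirichlet_eigenpair \<Omega> \<mu> v \<longrightarrow> (\<exists>k\<ge>1. L2_inner \<Omega> v (e k) \<noteq> 0)))"


text \<open>Point values at \<open>0\<close> are those of the continuous representative.\<close>

definition has_initial_value :: "real \<Rightarrow> (real \<Rightarrow> real) \<Rightarrow> real \<Rightarrow> bool" where
  "has_initial_value T w a \<longleftrightarrow>
     (\<exists>v. continuous_on {0..T} v \<and> (AE t in lebesgue_on {0<..<T}. v t = w t) \<and> v 0 = a)"

abbreviation time_deriv :: "real \<Rightarrow> (real \<Rightarrow> real) \<Rightarrow> real \<Rightarrow> real" where
  "time_deriv T w \<equiv> weak_partial {0<..<T} 1 w"

definition U_space :: "real \<Rightarrow> (real \<Rightarrow> real) set" where
  "U_space T = {w \<in> H2 {0<..<T}. has_initial_value T w 0 \<and> has_initial_value T (time_deriv T w) 0}"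

definition U_norm :: "real \<Rightarrow> real \<Rightarrow> real \<Rightarrow> (real \<Rightarrow> real) \<Rightarrow> real" where
  "U_norm T c l w = sqrt (l * (L2_norm {0<..<T} w)\<^sup>2
     + 1 / (c^4 * l) * (L2_norm {0<..<T} (time_deriv T (time_deriv T w)))\<^sup>2)"

definition solves_ode :: "real \<Rightarrow> real \<Rightarrow> real \<Rightarrow> (real \<Rightarrow> real) \<Rightarrow> (real \<Rightarrow> real) \<Rightarrow> bool" where
  "solves_ode T c l f u \<longleftrightarrow>
     (AE t in lebesgue_on {0<..<T}. 1 / c\<^sup>2 * time_deriv T (time_deriv T u) t + l * u t = f t)"

definition cos_part :: "real \<Rightarrow> (real \<Rightarrow> real) \<Rightarrow> real \<Rightarrow> real" where
  "cos_part \<mu> f t = (\<integral>s. f s * cos (sqrt \<mu> * s) \<partial>lebesgue_on {0..t})"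

definition sin_part :: "real \<Rightarrow> (real \<Rightarrow> real) \<Rightarrow> real \<Rightarrow> real" where
  "sin_part \<mu> f t = (\<integral>s. f s * sin (sqrt \<mu> * s) \<partial>lebesgue_on {0..t})"

end

theory Submission imports Defs begin

text \<open>Set \<open>\<mu> = c\<^sup>2 \<lambda>\<close> and \<open>\<omega> = sqrt \<mu>\<close>, so that \<open>u'' + \<mu> u = c\<^sup>2 f\<close>. The functions
  \<open>u' cos(\<omega> t) + \<omega> u sin(\<omega> t)\<close> and \<open>u' sin(\<omega> t) - \<omega> u cos(\<omega> t)\<close> vanish at \<open>0\<close> and have the
  derivatives \<open>c\<^sup>2 f cos(\<omega> t)\<close> and \<open>c\<^sup>2 f sin(\<omega> t)\<close>, so they equal \<open>c\<^sup>2 f\<^sup>c\<close> and \<open>c\<^sup>2 f\<^sup>s\<close>. Adding their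
  squares gives \<open>\<lambda> u\<^sup>2 + u'\<^sup>2 / c\<^sup>2 = c\<^sup>2 ((f\<^sup>c)\<^sup>2 + (f\<^sup>s)\<^sup>2)\<close> almost everywhere. The equation itself
  trades \<open>f\<close> for \<open>u''\<close> up to a multiple of \<open>u\<close>, which yields the constants \<open>1/3\<close> and \<open>3\<close>.\<close>

section \<open>Smooth functions of one variable\<close>

lemma frechet_derivative_real:
  fixes f :: "real \<Rightarrow> real"
  assumes "(f has_real_derivative d) (at x)"
  shows "frechet_derivative f (at x) 1 = d"
  using frechet_derivative_at[OF assms[unfolded has_field_derivative_def]] by (metis mult.right_neutral)

text \<open>On the line the only basis vector is \<open>1\<close>, and a derivative is
  multiplication by its value there, so the recursion through Frechet derivatives collapses to one
  ordinary derivative. The existential form lets each closure rule below supply an explicit formula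
  for it.\<close>

lemma cont_diff_Suc_real:
  fixes f :: "real \<Rightarrow> real"
  shows "cont_diff (Suc n) f \<longleftrightarrow>
    (\<exists>f'. (\<forall>x. (f has_real_derivative f' x) (at x)) \<and> cont_diff n f')"
proof
  assume L: "cont_diff (Suc n) f"
  have "(f has_real_derivative frechet_derivative f (at x) 1) (at x)" for x
  proof -
    have "(f has_derivative frechet_derivative f (at x)) (at x)"
      using L by (simp flip: frechet_derivative_works)
    moreover from this have "frechet_derivative f (at x) = (*) (frechet_derivative f (at x) 1)"
      by (metis has_derivative_linear mult.commute mult.right_neutral real_scaleR_def linear_cmul ext)
    ultimately show ?thesis by (metis has_field_derivative_def)
  qed
  with L show "\<exists>f'. (\<forall>x. (f has_real_derivative f' x) (at x)) \<and> cont_diff n f'"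
    by (intro exI[of _ "\<lambda>x. frechet_derivative f (at x) 1"]) auto
next
  assume "\<exists>f'. (\<forall>x. (f has_real_derivative f' x) (at x)) \<and> cont_diff n f'"
  then obtain f' where d: "\<And>x. (f has_real_derivative f' x) (at x)" and c: "cont_diff n f'" by blast
  note frechet_derivative_real[OF d]
  moreover have "f differentiable at x" for x
    using d real_differentiable_def by blast
  ultimately show "cont_diff (Suc n) f" using c by simp
qed

lemma cont_diff_imp_continuous:
  fixes f :: "real \<Rightarrow> real"
  assumes "cont_diff n f"
  shows "continuous_on A f"
proof (cases n)
  case 0
  then show ?thesis using assms continuous_on_subset by auto
next
  case (Suc m)
  then show ?thesis
    using assms DERIV_continuous_on has_field_derivative_at_within unfolding Suc cont_diff_Suc_real
    by metis
qed

text \<open>Used in the product and chain rules, where an undifferentiated factor must count as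
  being of the lower class.\<close>

lemma cont_diff_mono:
  fixes f :: "real \<Rightarrow> real"
  shows "cont_diff (Suc n) f \<Longrightarrow> cont_diff n f"
proof (induction n arbitrary: f)
  case 0
  then show ?case using cont_diff_imp_continuous[OF 0] by simp
next
  case (Suc n)
  then show ?case using cont_diff_Suc_real by blast
qed

lemma cont_diff_const: "cont_diff n (\<lambda>x::real. k)"
proof (induction n arbitrary: k)
  case (Suc n)
  then show ?case unfolding cont_diff_Suc_real by (intro exI[of _ "\<lambda>x. 0"]) auto
qed simp

lemma cont_diff_ident: "cont_diff n (\<lambda>x::real. x)"
proof (cases n)
  case (Suc m)
  then show ?thesis unfolding Suc cont_diff_Suc_real
    by (intro exI[of _ "\<lambda>x. 1"]) (auto simp: cont_diff_const)
qed simp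

lemma cont_diff_add:
  fixes f g :: "real \<Rightarrow> real"
  shows "cont_diff n f \<Longrightarrow> cont_diff n g \<Longrightarrow> cont_diff n (\<lambda>x. f x + g x)"
proof (induction n arbitrary: f g)
  case 0
  then show ?case by (simp add: continuous_on_add continuous_on_mult)
next
  case (Suc n)
  then obtain f' g' where "\<forall>x. (f has_real_derivative f' x) (at x)" "cont_diff n f'"
    "\<forall>x. (g has_real_derivative g' x) (at x)" "cont_diff n g'"
    unfolding cont_diff_Suc_real by blast
  then show ?case unfolding cont_diff_Suc_real
    by (intro exI[of _ "\<lambda>x. f' x + g' x"]) (simp add: Suc.IH DERIV_add)
qed

lemma cont_diff_mult:
  fixes f g :: "real \<Rightarrow> real"
  shows "cont_diff n f \<Longrightarrow> cont_diff n g \<Longrightarrow> cont_diff n (\<lambda>x. f x * g x)"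
proof (induction n arbitrary: f g)
  case 0
  then show ?case by (simp add: continuous_on_add continuous_on_mult)
next
  case (Suc n)
  then obtain f' g' where "\<forall>x. (f has_real_derivative f' x) (at x)" "cont_diff n f'"
    "\<forall>x. (g has_real_derivative g' x) (at x)" "cont_diff n g'"
    unfolding cont_diff_Suc_real by blast
  moreover note Suc.prems[THEN cont_diff_mono]
  ultimately show ?case unfolding cont_diff_Suc_real[of _ "\<lambda>x. f x * g x"]
    by (intro exI[of _ "\<lambda>x. f x * g' x + f' x * g x"])
      (simp add: cont_diff_add Suc.IH DERIV_mult')
qed

lemma cont_diff_compose:
  fixes f g :: "real \<Rightarrow> real"
  shows "cont_diff n f \<Longrightarrow> cont_diff n g \<Longrightarrow> cont_diff n (\<lambda>x. f (g x))"
proof (induction n arbitrary: f g)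
  case 0
  then show ?case by (auto intro: continuous_on_compose2)
next
  case (Suc n)
  then obtain f' g' where "\<forall>x. (f has_real_derivative f' x) (at x)" "cont_diff n f'"
    "\<forall>x. (g has_real_derivative g' x) (at x)" "cont_diff n g'"
    unfolding cont_diff_Suc_real by blast
  moreover note Suc.prems(2)[THEN cont_diff_mono]
  ultimately show ?case unfolding cont_diff_Suc_real[of _ "\<lambda>x. f (g x)"]
    by (intro exI[of _ "\<lambda>x. f' (g x) * g' x"])
      (simp add: cont_diff_mult Suc.IH DERIV_chain2)
qed

lemma cont_diff_diff:
  fixes f g :: "real \<Rightarrow> real"
  assumes "cont_diff n f" "cont_diff n g"
  shows "cont_diff n (\<lambda>x. f x - g x)"
  using cont_diff_add[OF assms(1) cont_diff_mult[OF cont_diff_const assms(2), of "-1"]] by simp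

text \<open>The two claims share one induction because each function is, up to a factor, the
  derivative of the other.\<close>

lemma cont_diff_sin_cos:
  fixes w :: real
  shows "cont_diff n (\<lambda>x. sin (w * x)) \<and> cont_diff n (\<lambda>x. cos (w * x))"
proof (induction n)
  case 0
  then show ?case by (auto intro!: continuous_intros)
next
  case (Suc n)
  have "cont_diff (Suc n) (\<lambda>x. sin (w * x))" unfolding cont_diff_Suc_real
    using Suc by (intro exI[of _ "\<lambda>x. w * cos (w * x)"])
      (auto simp: cont_diff_mult cont_diff_const intro!: derivative_eq_intros)
  moreover have "cont_diff (Suc n) (\<lambda>x. cos (w * x))" unfolding cont_diff_Suc_real
    using Suc cont_diff_mult[OF cont_diff_const, of n "\<lambda>x. sin (w * x)" "- w"]
    by (intro exI[of _ "\<lambda>x. (- w) * sin (w * x)"]) (auto intro!: derivative_eq_intros)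
  ultimately show ?case by blast
qed

section \<open>A smooth step function\<close>

text \<open>The exponent \<open>k\<close> is carried along so that derivatives stay within linear
  combinations of the family; the smooth step is built from \<open>flat 0\<close>.\<close>

definition flat :: "nat \<Rightarrow> real \<Rightarrow> real" where
  "flat k x = (if 0 < x then inverse x ^ k * exp (- inverse x) else 0)"

text \<open>From the right, substituting the inverse of \<open>x\<close> turns this into the decay
  of a power divided by an exponential at infinity.\<close>

lemma flat_tendsto_0: "(flat k \<longlongrightarrow> 0) (at 0)"
proof (rule filterlim_split_at_real)
  show "(flat k \<longlongrightarrow> 0) (at_left 0)"
    by (rule tendsto_eventually) (auto simp: flat_def eventually_at_filter)
  have "((\<lambda>x. inverse x ^ k / exp (inverse x)) \<longlongrightarrow> (0::real)) (at_right 0)"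
    by (rule filterlim_compose[OF tendsto_power_div_exp_0 filterlim_inverse_at_top_right])
  then show "(flat k \<longlongrightarrow> 0) (at_right 0)"
    by (rule Lim_transform_eventually)
      (auto simp: flat_def exp_minus divide_inverse eventually_at_filter)
qed

lemma flat_has_derivative:
  "(flat k has_real_derivative (flat (k + 2) x - k * flat (k + 1) x)) (at x)"
proof (cases x "0::real" rule: linorder_cases)
  case less
  have "((\<lambda>x. 0) has_real_derivative 0) (at x)" by simp
  moreover have "\<forall>\<^sub>F y in nhds x. 0 = flat k y"
    using eventually_nhds_in_open[of "{..<0}" x] less
    by (auto simp: flat_def elim!: eventually_mono)
  ultimately show ?thesis using less
    by (subst DERIV_cong_ev[OF refl _ refl, of _ "\<lambda>x. 0"]) (auto simp: flat_def elim!: eventually_mono)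
next
  case equal
  \<comment> \<open>At \<open>0\<close> the difference quotient of \<open>flat k\<close> is
    \<open>flat (Suc k)\<close>, which tends to \<open>0\<close>.\<close>
  have "((\<lambda>h. (flat k (0 + h) - flat k 0) / h) \<longlongrightarrow> 0) (at 0)"
    by (rule Lim_transform_eventually[OF flat_tendsto_0[of "Suc k"]])
       (auto simp: flat_def eventually_at_filter divide_inverse)
  then show ?thesis using equal by (simp add: DERIV_def flat_def)
next
  case greater
  \<comment> \<open>The power rule produces the truncated exponent \<open>k - 1\<close>, hence the
    case split on \<open>k\<close>.\<close>
  have "((\<lambda>x. inverse x ^ k) has_real_derivative - real k * inverse x ^ (k + 1)) (at x)"
    by (rule DERIV_cong, rule DERIV_power[OF DERIV_inverse])
      (use greater in \<open>cases k; simp add: algebra_simps\<close>)+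
  moreover have "((\<lambda>x. exp (- inverse x)) has_real_derivative inverse x ^ 2 * exp (- inverse x)) (at x)"
    using greater by (auto intro!: derivative_eq_intros simp: power2_eq_square)
  ultimately have "((\<lambda>x. inverse x ^ k * exp (- inverse x)) has_real_derivative
     (flat (k + 2) x - k * flat (k + 1) x)) (at x)"
    by (rule DERIV_cong[OF DERIV_mult'])
      (use greater in \<open>simp add: flat_def algebra_simps power2_eq_square\<close>)
  moreover have "\<forall>\<^sub>F y in nhds x. flat k y = inverse y ^ k * exp (- inverse y)"
    using eventually_nhds_in_open[of "{0<..}" x] greater
    by (auto simp: flat_def elim!: eventually_mono)
  ultimately show ?thesis 
    by (subst DERIV_cong_ev[OF refl _ refl]) auto
qed

text \<open>The induction must cover all \<open>k\<close> at once, since differentiating raises the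
  exponent.\<close>

lemma cont_diff_flat: "cont_diff n (flat k)"
proof (induction n arbitrary: k)
  case 0
  then show ?case
    using DERIV_continuous_on[OF has_field_derivative_at_within[OF flat_has_derivative]] by auto
next
  case (Suc n)
  then show ?case unfolding cont_diff_Suc_real
    by (intro exI[of _ "\<lambda>x. flat (k + 2) x - k * flat (k + 1) x"])
      (auto simp: cont_diff_diff cont_diff_mult[OF cont_diff_const] flat_has_derivative
        simp del: add_2_eq_Suc' One_nat_def)
qed

lemma cont_diff_deriv:
  fixes f :: "real \<Rightarrow> real"
  assumes "cont_diff (Suc n) f"
  shows "(f has_real_derivative deriv f x) (at x)" "cont_diff n (deriv f)"
proof -
  obtain f' where f': "\<And>x. (f has_real_derivative f' x) (at x)" "cont_diff n f'"
    using assms unfolding cont_diff_Suc_real by blast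
  then have "deriv f = f'" by (auto intro: DERIV_imp_deriv)
  then show "(f has_real_derivative deriv f x) (at x)" "cont_diff n (deriv f)" using f' by auto
qed

lemma flat_0_mono: "x \<le> y \<Longrightarrow> flat 0 x \<le> flat 0 y"
  by (auto simp: flat_def)

text \<open>The inner term is at least \<open>1\<close> for \<open>x \<le> 0\<close> and vanishes for \<open>x \<ge> 1\<close>, so composing \<open>flat 0\<close> with itself
  gives a smooth step without dividing by a sum of flat functions.\<close>

definition smooth_step :: "real \<Rightarrow> real" where
  "smooth_step x = exp 1 * flat 0 (1 - exp 1 * flat 0 (1 - x))"

lemma cont_diff_smooth_step: "cont_diff n smooth_step"
  unfolding smooth_step_def
  by (intro cont_diff_mult cont_diff_const cont_diff_diff cont_diff_ident
      cont_diff_compose[OF cont_diff_flat])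

lemma smooth_step_eq_0: 
  assumes "x \<le> 0" shows "smooth_step x = 0"
proof -
  \<comment> \<open>\<open>flat 0 1\<close> equals \<open>exp (- 1)\<close>, so after scaling by
    \<open>exp 1\<close> the outer \<open>flat 0\<close> receives a nonpositive argument.\<close>
  have "flat 0 1 \<le> flat 0 (1 - x)" by (rule flat_0_mono) (use assms in simp)
  then have "exp 1 * flat 0 1 \<le> exp 1 * flat 0 (1 - x)" by simp
  then show ?thesis by (simp add: smooth_step_def flat_def flip: exp_add)
qed

lemma smooth_step_eq_1: "x \<ge> 1 \<Longrightarrow> smooth_step x = 1"
  by (simp add: smooth_step_def flat_def flip: exp_add)

text \<open>The two order reversals, in \<open>1 - x\<close> and in the outer difference, cancel.
  Monotonicity is what makes the derivative a nonnegative kernel.\<close>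

lemma smooth_step_mono: "mono smooth_step"
  by (auto intro!: monoI flat_0_mono simp: smooth_step_def)

lemma smooth_step_bounds: "0 \<le> smooth_step x" "smooth_step x \<le> 1"
  using monoD[OF smooth_step_mono, of "min x 0" x] monoD[OF smooth_step_mono, of x "max x 1"]
  by (auto simp: smooth_step_eq_0 smooth_step_eq_1)

lemma smooth_step_has_derivative: "(smooth_step has_real_derivative deriv smooth_step x) (at x)"
  by (rule cont_diff_deriv(1)[OF cont_diff_smooth_step])

lemma deriv_smooth_step_nonneg: "0 \<le> deriv smooth_step x"
  using mono_on_imp_deriv_nonneg[of UNIV smooth_step, OF _ smooth_step_has_derivative]
    smooth_step_mono by simp

text \<open>The step is locally constant outside the closed unit interval. After rescaling by
  \<open>n\<close> the derivative therefore lives on an interval of length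
  \<open>1 / n\<close>.\<close>

lemma deriv_smooth_step_eq_0:
  assumes "x < 0 \<or> 1 < x"
  shows "deriv smooth_step x = 0"
proof -
  define I where "I = (if x < 0 then {..<0} else {1::real<..})"
  have "(smooth_step has_real_derivative 0) (at x)"
    by (rule has_field_derivative_transform_within_open[of "\<lambda>y. smooth_step x" _ _ I])
      (use assms in \<open>auto simp: I_def smooth_step_eq_0 smooth_step_eq_1\<close>)
  then show ?thesis by (rule DERIV_imp_deriv)
qed

section \<open>Weak derivatives on an interval\<close>

text \<open>Continuity on a compact superset \<open>K\<close> bounds \<open>g\<close>; in the
  applications \<open>S\<close> is typically an open interval, on which a continuous function could
  be unbounded.\<close>

lemma integrable_lebesgue_on_mult_continuous:
  fixes f g :: "real \<Rightarrow> real"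
  assumes f: "integrable (lebesgue_on S) f" and g: "continuous_on K g"
    and K: "compact K" "S \<subseteq> K" and S: "S \<in> sets lebesgue"
  shows "integrable (lebesgue_on S) (\<lambda>x. f x * g x)"
proof -
  obtain B where B: "\<And>x. x \<in> K \<Longrightarrow> norm (g x) \<le> B"
    using compact_imp_bounded[OF compact_continuous_image[OF g K(1)]] unfolding bounded_iff by auto
  have m: "g \<in> borel_measurable (lebesgue_on S)"
    using continuous_on_subset[OF g K(2)] S by (rule continuous_imp_measurable_on_sets_lebesgue)
  show ?thesis
  proof (rule Bochner_Integration.integrable_bound[of _ "\<lambda>x. f x * B"])
    show "integrable (lebesgue_on S) (\<lambda>x. f x * B)" using f by simp
    show "(\<lambda>x. f x * g x) \<in> borel_measurable (lebesgue_on S)" using f m by measurable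
    show "AE x in lebesgue_on S. norm (f x * g x) \<le> norm (f x * B)"
    proof (rule AE_I2)
      fix x assume "x \<in> space (lebesgue_on S)"
      then have "norm (g x) \<le> \<bar>B\<bar>" using B[of x] K by auto
      then show "norm (f x * g x) \<le> norm (f x * B)" by (simp add: abs_mult mult_left_mono)
    qed
  qed
qed

lemma integrable_lebesgue_on_supported:
  fixes h :: "real \<Rightarrow> real"
  assumes "K \<in> sets lebesgue" "S \<in> sets lebesgue" "K \<subseteq> S" "\<And>x. x \<notin> K \<Longrightarrow> h x = 0"
    and "integrable (lebesgue_on K) h"
  shows "integrable (lebesgue_on S) h"
proof -
  have "(\<lambda>x. indicat_real K x *\<^sub>R h x) = (\<lambda>x. indicat_real S x *\<^sub>R h x)"
    using assms(3,4) by (auto simp: indicator_def fun_eq_iff)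
  with assms show ?thesis by (simp add: integrable_restrict_space)
qed

text \<open>Since \<open>g\<close> vanishes off \<open>K\<close>, the integral only sees
  \<open>K\<close>, where local integrability of \<open>u\<close> applies.\<close>

lemma integrable_locally_integrable_mult:
  fixes u g :: "real \<Rightarrow> real"
  assumes u: "locally_integrable S u" and K: "compact K" "K \<subseteq> S" and S: "S \<in> sets lebesgue"
    and g: "continuous_on K g" "\<And>x. x \<notin> K \<Longrightarrow> g x = 0"
  shows "integrable (lebesgue_on S) (\<lambda>x. u x * g x)"
proof -
  have K': "K \<in> sets lebesgue" using K(1) by (simp add: compact_imp_closed)
  have "integrable (lebesgue_on K) u" using u K unfolding locally_integrable_def by blast
  then have "integrable (lebesgue_on K) (\<lambda>x. u x * g x)"
    using g(1) K by (intro integrable_lebesgue_on_mult_continuous[OF _ _ K(1) _ K']) auto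
  then show ?thesis by (intro integrable_lebesgue_on_supported[OF K' S]) (use K g in auto)
qed

lemma locally_integrable_mult:
  fixes u g :: "real \<Rightarrow> real"
  assumes "locally_integrable S u" "continuous_on UNIV g"
  shows "locally_integrable S (\<lambda>x. u x * g x)"
  unfolding locally_integrable_def
proof (intro allI impI)
  fix K assume K: "compact K \<and> K \<subseteq> S"
  then have "integrable (lebesgue_on K) u" using assms(1) unfolding locally_integrable_def by blast
  then show "integrable (lebesgue_on K) (\<lambda>x. u x * g x)"
    using K continuous_on_subset[OF assms(2)] compact_imp_closed[of K]
    by (intro integrable_lebesgue_on_mult_continuous) auto
qed

lemma test_function_deriv:
  fixes \<phi> :: "real \<Rightarrow> real"
  assumes "\<phi> \<in> test_functions S"
  shows "(\<phi> has_real_derivative deriv \<phi> x) (at x)" "frechet_derivative \<phi> (at x) 1 = deriv \<phi> x"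
proof -
  have "cont_diff (Suc 0) \<phi>" using assms unfolding test_functions_def by blast
  then show *: "(\<phi> has_real_derivative deriv \<phi> x) (at x)" by (rule cont_diff_deriv)
  then show "frechet_derivative \<phi> (at x) 1 = deriv \<phi> x" by (rule frechet_derivative_real)
qed

lemma integrable_mult_test_function:
  fixes \<phi> :: "real \<Rightarrow> real"
  assumes u: "locally_integrable S u" and \<phi>: "\<phi> \<in> test_functions S" and S: "S \<in> sets lebesgue"
  shows "integrable (lebesgue_on S) (\<lambda>x. u x * \<phi> x)"
    "integrable (lebesgue_on S) (\<lambda>x. u x * deriv \<phi> x)"
proof -
  obtain K where K: "compact K" "K \<subseteq> S" "\<And>x. x \<notin> K \<Longrightarrow> \<phi> x = 0" and s: "\<And>n. cont_diff n \<phi>"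
    using \<phi> unfolding test_functions_def by blast
  show "integrable (lebesgue_on S) (\<lambda>x. u x * \<phi> x)"
    by (rule integrable_locally_integrable_mult[OF u K(1,2) S cont_diff_imp_continuous[OF s] K(3)])
  \<comment> \<open>The complement of \<open>K\<close> is open, so \<phi> vanishes near each of its
    points and its derivative has the same support bound.\<close>
  have "deriv \<phi> x = 0" if "x \<notin> K" for x
  proof -
    have "(\<phi> has_real_derivative 0) (at x)"
      by (rule has_field_derivative_transform_within_open[of "\<lambda>y. 0" _ _ "- K"])
        (use that K compact_imp_closed in \<open>auto simp: open_Compl\<close>)
    then show ?thesis by (rule DERIV_imp_deriv)
  qed
  then show "integrable (lebesgue_on S) (\<lambda>x. u x * deriv \<phi> x)"
    by (intro integrable_locally_integrable_mult[OF u K(1,2) S]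
        cont_diff_imp_continuous[OF cont_diff_deriv(2)[OF s]])
qed

lemma has_weak_partial_iff_deriv:
  fixes u v :: "real \<Rightarrow> real"
  shows "has_weak_partial S 1 u v \<longleftrightarrow> locally_integrable S u \<and> locally_integrable S v \<and>
    (\<forall>\<phi>\<in>test_functions S.
      (\<integral>x. u x * deriv \<phi> x \<partial>lebesgue_on S) = - (\<integral>x. v x * \<phi> x \<partial>lebesgue_on S))"
  unfolding has_weak_partial_def L2_inner_def by (auto simp: test_function_deriv(2))

lemma has_weak_partial_add:
  fixes u v :: "real \<Rightarrow> real"
  assumes S: "S \<in> sets lebesgue" and "has_weak_partial S 1 u v" "has_weak_partial S 1 u' v'"
  shows "has_weak_partial S 1 (\<lambda>x. u x + u' x) (\<lambda>x. v x + v' x)"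
  unfolding has_weak_partial_iff_deriv
proof (intro conjI ballI)
  have *: "locally_integrable S u" "locally_integrable S v" "locally_integrable S u'"
    "locally_integrable S v'" using assms unfolding has_weak_partial_def by auto
  then show "locally_integrable S (\<lambda>x. u x + u' x)" "locally_integrable S (\<lambda>x. v x + v' x)"
    unfolding locally_integrable_def by auto
  fix \<phi> assume \<phi>: "\<phi> \<in> test_functions S"
  note i = *[THEN integrable_mult_test_function(1), OF \<phi> S]
    *[THEN integrable_mult_test_function(2), OF \<phi> S]
  show "(\<integral>x. (u x + u' x) * deriv \<phi> x \<partial>lebesgue_on S) = - (\<integral>x. (v x + v' x) * \<phi> x \<partial>lebesgue_on S)"
    using assms(2,3) \<phi> i unfolding has_weak_partial_iff_deriv by (simp add: distrib_right)
qed

text \<open>The product of \<open>g\<close> with a test function is again a test function. Testing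
  the weak derivative of \<open>u\<close> with it and moving the term containing
  \<open>deriv g\<close> to the other side gives the product rule.\<close>

lemma has_weak_partial_mult:
  fixes u v g :: "real \<Rightarrow> real"
  assumes S: "S \<in> sets lebesgue" and w: "has_weak_partial S 1 u v" and g: "\<And>n. cont_diff n g"
  shows "has_weak_partial S 1 (\<lambda>x. u x * g x) (\<lambda>x. v x * g x + u x * deriv g x)"
  unfolding has_weak_partial_iff_deriv
proof (intro conjI ballI)
  have l: "locally_integrable S u" "locally_integrable S v"
    using w unfolding has_weak_partial_def by auto
  note c = cont_diff_imp_continuous[OF g[of 0]] cont_diff_imp_continuous[OF cont_diff_deriv(2)[OF g]]
  note l' = locally_integrable_mult[OF l(1) c(1)] locally_integrable_mult[OF l(2) c(1)]
    locally_integrable_mult[OF l(1) c(2)]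
  show "locally_integrable S (\<lambda>x. u x * g x)" by (rule l')
  show "locally_integrable S (\<lambda>x. v x * g x + u x * deriv g x)"
    using l'(2,3) unfolding locally_integrable_def by (simp add: Bochner_Integration.integrable_add)
  fix \<phi> assume \<phi>: "\<phi> \<in> test_functions S"
  note i = l'[THEN integrable_mult_test_function(1), OF \<phi> S]
    l'[THEN integrable_mult_test_function(2), OF \<phi> S]
  have g\<phi>: "(\<lambda>x. g x * \<phi> x) \<in> test_functions S"
  proof -
    obtain K where "compact K" "K \<subseteq> S" "\<And>x. x \<notin> K \<Longrightarrow> \<phi> x = 0" and s: "\<And>n. cont_diff n \<phi>"
      using \<phi> unfolding test_functions_def by blast
    then have "\<exists>K. compact K \<and> K \<subseteq> S \<and> (\<forall>x. x \<notin> K \<longrightarrow> g x * \<phi> x = 0)" by auto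
    with cont_diff_mult[OF g s] show ?thesis unfolding test_functions_def by blast
  qed
  have "deriv (\<lambda>x. g x * \<phi> x) x = deriv g x * \<phi> x + g x * deriv \<phi> x" for x
    using DERIV_mult'[OF cont_diff_deriv(1)[OF g] test_function_deriv(1)[OF \<phi>], of x]
    by (simp add: DERIV_imp_deriv add.commute)
  then have "(\<integral>x. u x * g x * deriv \<phi> x + u x * deriv g x * \<phi> x \<partial>lebesgue_on S) =
    - (\<integral>x. v x * g x * \<phi> x \<partial>lebesgue_on S)"
    using bspec[OF conjunct2[OF conjunct2[OF w[unfolded has_weak_partial_iff_deriv]]] g\<phi>]
    by (simp add: algebra_simps)
  then show "(\<integral>x. u x * g x * deriv \<phi> x \<partial>lebesgue_on S) =
    - (\<integral>x. (v x * g x + u x * deriv g x) * \<phi> x \<partial>lebesgue_on S)"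
    using i by (simp add: distrib_right)
qed

lemma integrable_lebesgue_on_subset:
  fixes f :: "real \<Rightarrow> real"
  assumes "integrable (lebesgue_on B) f" "A \<subseteq> B" "A \<in> sets lebesgue" "B \<in> sets lebesgue"
  shows "integrable (lebesgue_on A) f"
  using assms set_integrable_subset[of lebesgue B f A]
  by (simp add: integrable_restrict_space set_integrable_def)

text \<open>Holds by completeness of Lebesgue measure, after extending both functions by
  \<open>0\<close>.\<close>

lemma borel_measurable_lebesgue_on_AE:
  fixes f g :: "real \<Rightarrow> real"
  assumes f: "f \<in> borel_measurable (lebesgue_on S)" and S: "S \<in> sets lebesgue"
    and ae: "AE x in lebesgue_on S. f x = g x"
  shows "g \<in> borel_measurable (lebesgue_on S)"
proof (rule borel_measurable_if_D, rule borel_measurable_AE)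
  show "(\<lambda>x. if x \<in> S then f x else 0) \<in> borel_measurable lebesgue"
    using f S by (rule borel_measurable_if_I)
  have "AE x in lebesgue. x \<in> S \<longrightarrow> f x = g x"
    using ae S by (subst (asm) AE_restrict_space_iff) auto
  then show "AE x in lebesgue. (if x \<in> S then f x else 0) = (if x \<in> S then g x else 0)" by auto
qed

text \<open>On a set of finite measure \<open>1 + (f x)\<^sup>2\<close> is an integrable bound for
  \<open>f\<close>.\<close>

lemma L2_imp_integrable:
  fixes f :: "real \<Rightarrow> real"
  assumes f: "f \<in> L2 S" and S: "S \<in> lmeasurable"
  shows "integrable (lebesgue_on S) f"
proof -
  interpret finite_measure "lebesgue_on S" using S by (rule finite_measure_lebesgue_on)
  show ?thesis
  proof (rule Bochner_Integration.integrable_bound[of _ "\<lambda>x. 1 + (f x)\<^sup>2"])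
    show "integrable (lebesgue_on S) (\<lambda>x. 1 + (f x)\<^sup>2)" using f unfolding L2_def by auto
    show "f \<in> borel_measurable (lebesgue_on S)" using f unfolding L2_def by auto
    have "\<bar>y\<bar> \<le> 1 + y\<^sup>2" for y :: real using sum_squares_bound[of 1 "\<bar>y\<bar>"] by simp
    then show "AE x in lebesgue_on S. norm (f x) \<le> norm (1 + (f x)\<^sup>2)" by simp
  qed
qed

section \<open>Approximate identities and the increment formula for weak derivatives\<close>

text \<open>The kernel is the derivative of a step that climbs from \<open>0\<close> to
  \<open>1\<close> between \<open>y\<close> and \<open>y + 1 / n\<close>. The hypotheses place this
  interval inside the domain, so the fundamental theorem of calculus gives mass
  \<open>1\<close>.\<close>

lemma integral_smooth_step_kernel:
  fixes a b y :: real and n :: nat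
  assumes "a < y" "0 < n" "y + 1 / n < b"
  shows "integrable (lebesgue_on {a<..<b}) (\<lambda>x. n * deriv smooth_step (n * (x - y)))"
    "(\<integral>x. n * deriv smooth_step (n * (x - y)) \<partial>lebesgue_on {a<..<b}) = 1"
proof -
  have c: "continuous_on {a..b} (\<lambda>x. n * deriv smooth_step (n * (x - y)))"
    by (intro cont_diff_imp_continuous[of 0] cont_diff_mult cont_diff_const cont_diff_diff
        cont_diff_ident cont_diff_compose[OF cont_diff_deriv(2)[OF cont_diff_smooth_step]])
  have "integrable (lebesgue_on {a..b}) (\<lambda>x. n * deriv smooth_step (n * (x - y)))"
    using c by (rule continuous_imp_integrable_real)
  then show i: "integrable (lebesgue_on {a<..<b}) (\<lambda>x. n * deriv smooth_step (n * (x - y)))"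
    by (rule integrable_lebesgue_on_subset) auto
  have "((\<lambda>x. n * deriv smooth_step (n * (x - y))) has_integral
      smooth_step (n * (b - y)) - smooth_step (n * (a - y))) {a..b}"
  proof (rule fundamental_theorem_of_calculus)
    show "a \<le> b" using assms by (smt (verit) divide_nonneg_nonneg of_nat_0_le_iff)
    show "((\<lambda>x. smooth_step (n * (x - y))) has_vector_derivative
        n * deriv smooth_step (n * (x - y))) (at x within {a..b})" for x
    proof -
      have "((\<lambda>x. n * (x - y)) has_real_derivative n) (at x)"
        by (auto intro!: derivative_eq_intros)
      from DERIV_chain2[OF smooth_step_has_derivative this] show ?thesis
        by (simp add: has_field_derivative_at_within mult.commute
            flip: has_real_derivative_iff_has_vector_derivative)
    qed
  qed
  moreover have "1 \<le> n * (b - y)" using assms by (simp add: field_simps)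
  moreover have "n * (a - y) \<le> 0" using assms by (simp add: mult_le_0_iff)
  ultimately have "((\<lambda>x. n * deriv smooth_step (n * (x - y))) has_integral 1) {a..b}"
    by (simp add: smooth_step_eq_0 smooth_step_eq_1)
  then have "integral {a<..<b} (\<lambda>x. n * deriv smooth_step (n * (x - y))) = 1"
    unfolding integral_open_interval_real[symmetric] by (rule integral_unique)
  moreover have "(\<integral>x. n * deriv smooth_step (n * (x - y)) \<partial>lebesgue_on {a<..<b}) =
    integral {a<..<b} (\<lambda>x. n * deriv smooth_step (n * (x - y)))"
    using i by (rule lebesgue_integral_eq_integral) simp
  ultimately show "(\<integral>x. n * deriv smooth_step (n * (x - y)) \<partial>lebesgue_on {a<..<b}) = 1"
    by (rule trans[rotated])
qed

text \<open>Nonnegative kernels of mass \<open>1\<close> concentrating at \<open>y\<close> from the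
  right average \<open>P\<close> over ever smaller intervals, so continuity of \<open>P\<close>
  gives the limit.\<close>

lemma smooth_step_kernel_tendsto:
  fixes P :: "real \<Rightarrow> real"
  assumes P: "continuous_on {a..b} P" and y: "y \<in> {a<..<b}"
  shows "(\<lambda>n. \<integral>x. P x * (real n * deriv smooth_step (real n * (x - y))) \<partial>lebesgue_on {a<..<b})
    \<longlonglongrightarrow> P y"
proof (rule LIMSEQ_I)
  fix \<epsilon> :: real assume "0 < \<epsilon>"
  then have e: "0 < \<epsilon> / 2" by simp
  let ?M = "lebesgue_on {a<..<b}"
  obtain \<delta> where \<delta>: "\<delta> > 0" "\<And>x. x \<in> {a..b} \<Longrightarrow> \<bar>x - y\<bar> < \<delta> \<Longrightarrow> \<bar>P x - P y\<bar> < \<epsilon> / 2"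
    using P[unfolded continuous_on_iff, rule_format, OF _ e, of y] y by (auto simp: dist_real_def)
  \<comment> \<open>The support length \<open>1 / n\<close> has to stay below \<delta> and below the
    room to the right of \<open>y\<close>. Starting at \<open>Suc N\<close> also keeps
    \<open>n\<close> positive.\<close>
  obtain N where N: "inverse (real (Suc N)) < min \<delta> (b - y)"
    using reals_Archimedean[of "min \<delta> (b - y)"] \<delta> y by auto
  show "\<exists>N. \<forall>n\<ge>N. norm ((\<integral>x. P x * (real n * deriv smooth_step (real n * (x - y))) \<partial>?M) - P y) < \<epsilon>"
  proof (intro exI allI impI)
    fix n assume n: "Suc N \<le> n"
    have "1 / n \<le> 1 / Suc N" using n by (intro divide_left_mono) auto
    with N have n': "1 / n < \<delta>" "y + 1 / n < b" "0 < n" using n by (auto simp: inverse_eq_divide)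
    define k where "k x = n * deriv smooth_step (n * (x - y))" for x
    have k: "integrable ?M k" "integral\<^sup>L ?M k = 1"
      using integral_smooth_step_kernel[of a y n b] y n' by (auto simp: k_def[abs_def])
    have Pk: "integrable ?M (\<lambda>x. k x * P x)"
      by (rule integrable_lebesgue_on_mult_continuous[OF k(1) P]) auto
    have *: "\<bar>k x * P x - k x * P y\<bar> \<le> \<epsilon> / 2 * k x" if "x \<in> {a<..<b}" for x
    proof (cases "\<bar>x - y\<bar> < \<delta>")
      case True
      have "0 \<le> k x" by (simp add: k_def deriv_smooth_step_nonneg)
      moreover have "\<bar>P x - P y\<bar> \<le> \<epsilon> / 2" using \<delta>(2)[of x] True that by auto
      ultimately have "k x * \<bar>P x - P y\<bar> \<le> k x * (\<epsilon> / 2)" by (intro mult_left_mono)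
      moreover have "\<bar>k x * P x - k x * P y\<bar> = k x * \<bar>P x - P y\<bar>"
        using \<open>0 \<le> k x\<close> by (metis abs_mult abs_of_nonneg right_diff_distrib)
      ultimately show ?thesis by (simp add: mult.commute)
    next
      case False
      \<comment> \<open>A point at distance at least \<delta> from \<open>y\<close> lies outside the
        support of the kernel, because \<open>1 / n\<close> is smaller than \<delta>.\<close>
      then have "x < y \<or> y + 1 / n < x" using n' by linarith
      then have "n * (x - y) < 0 \<or> 1 < n * (x - y)"
        using n' by (auto simp: mult_less_0_iff field_simps)
      then show ?thesis by (simp add: k_def deriv_smooth_step_eq_0)
    qed
    have "\<bar>\<integral>x. k x * P x - k x * P y \<partial>?M\<bar> \<le> (\<integral>x. \<epsilon> / 2 * k x \<partial>?M)"
      using * Pk k by (intro integral_abs_bound_integral) auto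
    also have "\<dots> < \<epsilon>" using k \<open>0 < \<epsilon>\<close> by simp
    also have "(\<integral>x. k x * P x - k x * P y \<partial>?M) = (\<integral>x. P x * k x \<partial>?M) - P y"
      using Pk k by (simp add: mult.commute)
    finally show "norm ((\<integral>x. P x * (real n * deriv smooth_step (real n * (x - y))) \<partial>?M) - P y) < \<epsilon>"
      by (simp add: k_def)
  qed
qed

text \<open>At \<open>x = s\<close> every scaled step is \<open>0\<close>, so the limit is the
  indicator of the ray without its endpoint.\<close>

lemma smooth_step_scaled_tendsto:
  "(\<lambda>n. smooth_step (real n * (x - s))) \<longlonglongrightarrow> indicat_real {s<..} x"
proof (cases "s < x")
  case True
  obtain N :: nat where N: "1 / (x - s) \<le> N" using real_arch_simple by blast
  have "smooth_step (real n * (x - s)) = 1" if "N \<le> n" for n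
  proof (rule smooth_step_eq_1)
    have "1 / (x - s) \<le> n" using N that by linarith
    then show "1 \<le> n * (x - s)" using True by (simp add: field_simps)
  qed
  with True show ?thesis by (intro tendsto_eventually) (auto simp: eventually_sequentially)
next
  case False
  then have "smooth_step (real n * (x - s)) = 0" for n
    by (intro smooth_step_eq_0) (simp add: mult_le_0_iff)
  with False show ?thesis by simp
qed

text \<open>Testing the weak derivative with the difference of two steepening smooth steps at \<open>s\<close> and
  \<open>t\<close>, whose derivatives are approximate identities at \<open>s\<close> and \<open>t\<close>.\<close>

lemma has_weak_partial_imp_increment_interior:
  fixes P p w :: "real \<Rightarrow> real"
  assumes w: "has_weak_partial {a<..<b} 1 w p" and p: "integrable (lebesgue_on {a<..<b}) p"
    and P: "continuous_on {a..b} P" and ae: "AE x in lebesgue_on {a<..<b}. P x = w x"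
    and st: "a < s" "s < t" "t < b"
  shows "P t - P s = integral {s..t} p"
proof -
  let ?M = "lebesgue_on {a<..<b}"
  define k where "k y n x = real n * deriv smooth_step (real n * (x - y))" for y n x
  define \<phi> where "\<phi> n x = smooth_step (real n * (x - s)) - smooth_step (real n * (x - t))" for n x
  have sm: "cont_diff m (\<phi> n)" for m n
    unfolding \<phi>_def by (intro cont_diff_mult cont_diff_const cont_diff_diff
        cont_diff_ident cont_diff_compose[OF cont_diff_smooth_step])
  have d: "deriv (\<phi> n) x = k s n x - k t n x" for n x
    unfolding \<phi>_def k_def
    by (rule DERIV_imp_deriv)
      (auto intro!: derivative_eq_intros DERIV_chain2[OF smooth_step_has_derivative])
  have kc: "continuous_on A (k y n)" for A y n
    unfolding k_def by (intro cont_diff_imp_continuous[of 0] cont_diff_mult cont_diff_const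
        cont_diff_diff cont_diff_ident
        cont_diff_compose[OF cont_diff_deriv(2)[OF cont_diff_smooth_step]])
  have "integrable (lebesgue_on {a..b}) P" using P by (rule continuous_imp_integrable_real)
  then have Pi: "integrable ?M P" by (rule integrable_lebesgue_on_subset) auto
  have Pk: "integrable ?M (\<lambda>x. P x * k y n x)" for y n
    by (rule integrable_lebesgue_on_mult_continuous[OF Pi kc[of "{a..b}"]]) auto
  have pm: "p \<in> borel_measurable ?M" using p by simp
  have \<phi>m: "\<phi> n \<in> borel_measurable ?M" for n
    using cont_diff_imp_continuous[OF sm[of 0 n]]
    by (intro continuous_imp_measurable_on_sets_lebesgue) auto
  have "(\<lambda>n. (\<integral>x. P x * k s n x \<partial>?M) - (\<integral>x. P x * k t n x \<partial>?M)) \<longlonglongrightarrow> P s - P t"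
    unfolding k_def using st by (intro tendsto_diff smooth_step_kernel_tendsto[OF P]) auto
  moreover have "\<forall>\<^sub>F n in sequentially. (\<integral>x. P x * k s n x \<partial>?M) - (\<integral>x. P x * k t n x \<partial>?M) =
    - (\<integral>x. p x * \<phi> n x \<partial>?M)"
  proof -
    obtain N where N: "inverse (real (Suc N)) < b - t"
      using reals_Archimedean[of "b - t"] st by auto
    have "(\<integral>x. P x * k s n x \<partial>?M) - (\<integral>x. P x * k t n x \<partial>?M) = - (\<integral>x. p x * \<phi> n x \<partial>?M)"
      if n: "Suc N \<le> n" for n
    proof -
      have "1 / n \<le> 1 / Suc N" using n by (intro divide_left_mono) auto
      with N have n': "t + 1 / n < b" "0 < n" using n by (auto simp: inverse_eq_divide)
      \<comment> \<open>Left of \<open>s\<close> both steps are \<open>0\<close>, right of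
        \<open>t + 1 / n\<close> both are \<open>1\<close>. For large \<open>n\<close> the support
        is thus a compact subset of the open interval.\<close>
      have "\<phi> n x = 0" if "x \<notin> {s..t + 1 / n}" for x
      proof (cases "x < s")
        case True
        then have "n * (x - s) \<le> 0" "n * (x - t) \<le> 0" using st by (auto simp: mult_le_0_iff)
        then show ?thesis by (simp add: \<phi>_def smooth_step_eq_0)
      next
        case False
        then have "t + 1 / n < x" using that by auto
        then have "1 \<le> n * (x - t)" using n' by (simp add: field_simps)
        moreover have "n * (x - t) \<le> n * (x - s)" using st by (intro mult_left_mono) auto
        ultimately show ?thesis by (simp add: \<phi>_def smooth_step_eq_1)
      qed
      then have test: "\<phi> n \<in> test_functions {a<..<b}"
        unfolding test_functions_def using sm st n'
        by (auto intro!: exI[of _ "{s..t + 1 / n}"])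
      have "(\<integral>x. P x * k s n x \<partial>?M) - (\<integral>x. P x * k t n x \<partial>?M) = (\<integral>x. P x * deriv (\<phi> n) x \<partial>?M)"
        using Pk by (simp add: d right_diff_distrib)
      also have "\<dots> = (\<integral>x. w x * deriv (\<phi> n) x \<partial>?M)"
      proof (rule integral_cong_AE)
        show "(\<lambda>x. P x * deriv (\<phi> n) x) \<in> borel_measurable ?M"
          using Pk[of s n] Pk[of t n] by (auto simp: d right_diff_distrib)
        show "(\<lambda>x. w x * deriv (\<phi> n) x) \<in> borel_measurable ?M"
          using integrable_mult_test_function(2)[OF _ test, of w] w
          unfolding has_weak_partial_def by auto
        show "AE x in ?M. P x * deriv (\<phi> n) x = w x * deriv (\<phi> n) x" using ae by auto
      qed
      also have "\<dots> = - (\<integral>x. p x * \<phi> n x \<partial>?M)"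
        using w test unfolding has_weak_partial_iff_deriv by blast
      finally show ?thesis .
    qed
    then show ?thesis unfolding eventually_sequentially by blast
  qed
  ultimately have 1: "(\<lambda>n. - (\<integral>x. p x * \<phi> n x \<partial>?M)) \<longlonglongrightarrow> P s - P t"
    by (rule Lim_transform_eventually)
  \<comment> \<open>The pointwise limit of the test functions, which is the indicator of
    \<open>{s<..t}\<close>. As the test functions are bounded by \<open>1\<close> in absolute value,
    \<open>norm (p x)\<close> dominates the integrands.\<close>
  let ?\<chi> = "\<lambda>x. indicat_real {s<..} x - indicat_real {t<..} x"
  have \<phi>1: "\<bar>\<phi> n x\<bar> \<le> 1" for n x
    using smooth_step_bounds[of "n * (x - s)"] smooth_step_bounds[of "n * (x - t)"]
    unfolding \<phi>_def by linarith
  have bd: "norm (p x * \<phi> n x) \<le> norm (p x)" for x n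
    using mult_left_mono[OF \<phi>1, of "\<bar>p x\<bar>"] by (simp add: abs_mult)
  have \<chi>m: "?\<chi> \<in> borel_measurable ?M"
    by (intro measurable_restrict_space1 measurable_completion borel_measurable_diff) auto
  have 2: "(\<lambda>n. (\<integral>x. p x * \<phi> n x \<partial>?M)) \<longlonglongrightarrow> (\<integral>x. p x * ?\<chi> x \<partial>?M)"
  proof (rule integral_dominated_convergence[where w = "\<lambda>x. norm (p x)"])
    show "AE x in ?M. (\<lambda>n. p x * \<phi> n x) \<longlonglongrightarrow> p x * ?\<chi> x"
      unfolding \<phi>_def by (intro AE_I2 tendsto_intros smooth_step_scaled_tendsto)
    show "(\<lambda>x. p x * \<phi> n x) \<in> borel_measurable ?M" for n
      using pm \<phi>m by measurable
    show "(\<lambda>x. p x * ?\<chi> x) \<in> borel_measurable ?M"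
      using pm \<chi>m by (rule borel_measurable_times)
  qed (use p bd in auto)
  have \<chi>i: "integrable ?M (\<lambda>x. p x * ?\<chi> x)"
    by (rule Bochner_Integration.integrable_bound[OF p borel_measurable_times[OF pm \<chi>m]])
      (auto simp: indicator_def abs_mult)
  have "(\<integral>x. p x * ?\<chi> x \<partial>?M) = integral {a<..<b} (\<lambda>x. p x * ?\<chi> x)"
    using \<chi>i by (rule lebesgue_integral_eq_integral) auto
  also have "\<dots> = integral {a<..<b} (\<lambda>x. if x \<in> {s<..t} then p x else 0)"
    using st by (intro integral_cong) (auto simp: indicator_def)
  also have "\<dots> = integral {s<..t} p" 
  proof -
    have "{s<..t} \<inter> {a<..<b} = {s<..t}" using st by auto
    then show ?thesis by (simp only: integral_restrict_Int)
  qed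
  also have "\<dots> = integral {s..t} p"
    by (rule integral_subset_negligible) (auto intro: negligible_subset[of "{s}"])
  finally have "- P t + P s = - integral {s..t} p"
    using LIMSEQ_unique[OF 1 tendsto_minus[OF 2]] by simp
  then show ?thesis by simp
qed

text \<open>Extends the increment formula to the left endpoint, where the initial values live: the
  defect \<open>h\<close> is continuous up to \<open>a\<close> and vanishes on the open interval,
  hence also at \<open>a\<close>.\<close>

lemma has_weak_partial_imp_increment:
  fixes P p w :: "real \<Rightarrow> real"
  assumes w: "has_weak_partial {a<..<b} 1 w p" and p: "integrable (lebesgue_on {a<..<b}) p"
    and P: "continuous_on {a..b} P" and ae: "AE x in lebesgue_on {a<..<b}. P x = w x"
    and t: "t \<in> {a<..<b}"
  shows "P t - P a = integral {a..t} p"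
proof -
  have "integrable (lebesgue_on {a<..<t}) p"
    using p by (rule integrable_lebesgue_on_subset) (use t in auto)
  then have "p integrable_on {a<..<t}" by (intro integrable_on_lebesgue_on) auto
  then have pi: "p integrable_on {a..t}" by (simp add: integrable_on_open_interval_real)
  define h where "h s = P t - P s - integral {s..t} p" for s
  have "continuous_on {a..t} h"
    unfolding h_def
    by (intro continuous_on_diff continuous_on_const indefinite_integral_continuous_1' pi
        continuous_on_subset[OF P]) (use t in auto)
  moreover have "h s = 0" if "s \<in> {a<..<t}" for s
    using has_weak_partial_imp_increment_interior[OF w p P ae, of s t] that t by (simp add: h_def)
  moreover have "closure {a<..<t} = {a..t}" using t by simp
  ultimately have "h a = 0"
    using t continuous_constant_on_closure[of "{a<..<t}" h 0 a] by auto
  then show ?thesis by (simp add: h_def)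
qed

section \<open>The oscillator equation\<close>

lemma L2_norm_power2: "(L2_norm S f)\<^sup>2 = (\<integral>x. (f x)\<^sup>2 \<partial>lebesgue_on S)"
  by (simp add: L2_norm_def L2_inner_def power2_eq_square)

text \<open>Membership in \<open>H1\<close> supplies a weak derivative, so the choice behind
  \<open>weak_partial\<close> is meaningful.\<close>

lemma has_weak_partial_time_deriv:
  assumes "w \<in> H1 {0<..<T}"
  shows "has_weak_partial {0<..<T} 1 w (time_deriv T w)"
proof -
  have "\<exists>v. has_weak_partial {0<..<T} 1 w v" using assms unfolding H1_def by auto
  then show ?thesis unfolding weak_partial_def by (rule someI_ex)
qed

text \<open>If \<open>u'' + \<mu> u = f\<close> and \<open>g'' = - \<mu> g\<close>, then \<open>(u' g - u g')' = f g\<close>.\<close>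

lemma oscillator_wronskian:
  fixes u q r f g V W :: "real \<Rightarrow> real" and \<mu> :: real
  assumes u: "has_weak_partial {0<..<T} 1 u q" "integrable (lebesgue_on {0<..<T}) u"
    and q: "has_weak_partial {0<..<T} 1 q r" 
    and r: "integrable (lebesgue_on {0<..<T}) r"
    and f: "integrable (lebesgue_on {0<..<T}) f"
    and ode: "AE x in lebesgue_on {0<..<T}. r x + \<mu> * u x = f x"
    and V: "continuous_on {0..T} V" "AE x in lebesgue_on {0<..<T}. V x = u x" "V 0 = 0"
    and W: "continuous_on {0..T} W" "AE x in lebesgue_on {0<..<T}. W x = q x" "W 0 = 0"
    and g: "\<And>n. cont_diff n g" "\<And>x. deriv (deriv g) x = - \<mu> * g x"
    and t: "t \<in> {0<..<T}"
  shows "W t * g t - V t * deriv g t = (\<integral>x. f x * g x \<partial>lebesgue_on {0..t})"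
proof -
  let ?S = "{0<..<T}"
  \<comment> \<open>The Wronskian is written as the sum of \<open>q x * g x\<close> and
    \<open>u x * g2 x\<close>, so that the product rule for a smooth multiplier applies to each
    term.\<close>
  define g2 where "g2 x = - deriv g x" for x
  have g2: "cont_diff n g2" for n
    using cont_diff_diff[OF cont_diff_const[of n 0] cont_diff_deriv(2)[OF g(1)]]
    by (simp add: g2_def[abs_def])
  have g2': "deriv g2 x = \<mu> * g x" for x
    using DERIV_minus[OF cont_diff_deriv(1)[OF cont_diff_deriv(2)[OF g(1)]]]
    by (intro DERIV_imp_deriv) (simp add: g2_def[abs_def] g(2) flip: minus_mult_left)
  note gc = cont_diff_imp_continuous[OF g(1)[of 0]] cont_diff_imp_continuous[OF g2[of 0]]
  have S: "?S \<in> sets lebesgue" by simp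
  \<comment> \<open>The cross terms with \<open>q\<close> cancel because \<open>g2\<close> is the
    negative of \<open>deriv g\<close>.\<close>
  have "(\<lambda>x. r x * g x + q x * deriv g x + (q x * g2 x + u x * deriv g2 x)) =
    (\<lambda>x. (r x + \<mu> * u x) * g x)"
    by (auto simp: g2' g2_def algebra_simps)
  with has_weak_partial_add[OF S has_weak_partial_mult[OF S q g(1)] has_weak_partial_mult[OF S u(1) g2]]
  have wp: "has_weak_partial ?S 1 (\<lambda>x. q x * g x + u x * g2 x) (\<lambda>x. (r x + \<mu> * u x) * g x)"
    by simp
  have pi: "integrable (lebesgue_on ?S) (\<lambda>x. (r x + \<mu> * u x) * g x)"
    by (rule integrable_lebesgue_on_mult_continuous[where K = "{0..T}"])
      (use u(2) r gc in auto)
  have fgi: "integrable (lebesgue_on ?S) (\<lambda>x. f x * g x)"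
    by (rule integrable_lebesgue_on_mult_continuous[where K = "{0..T}"])
      (use f gc in auto)
  \<comment> \<open>The continuous representative of the Wronskian is formed from \<open>V\<close>
    and \<open>W\<close>, so its value at \<open>0\<close> is the one fixed by the initial
    conditions.\<close>
  have "W t * g t + V t * g2 t - (W 0 * g 0 + V 0 * g2 0) =
      integral {0..t} (\<lambda>x. (r x + \<mu> * u x) * g x)"
    by (rule has_weak_partial_imp_increment[OF wp pi _ _ t])
      (use V W gc in \<open>auto intro!: continuous_intros\<close>)
  also have "\<dots> = integral {0..t} (\<lambda>x. f x * g x)"
  proof -
    have "AE x in lebesgue. x \<in> ?S \<longrightarrow> r x + \<mu> * u x = f x"
      using ode by (subst (asm) AE_restrict_space_iff) auto
    then obtain N where N: "N \<in> null_sets lebesgue"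
      "\<And>x. x \<notin> N \<Longrightarrow> x \<in> ?S \<Longrightarrow> r x + \<mu> * u x = f x"
      unfolding completion.AE_iff_null_sets by auto
    show ?thesis
    proof (rule integral_spike)
      \<comment> \<open>The point \<open>0\<close> lies in the range of integration but not in the
        open interval on which the equation holds, so it joins the exceptional set.\<close>
      show "negligible (insert 0 N)" using N(1) by (simp add: negligible_iff_null_sets)
      show "f x * g x = (r x + \<mu> * u x) * g x" if "x \<in> {0..t} - insert 0 N" for x
        using N(2)[of x] that t by auto
    qed
  qed
  also have "\<dots> = (\<integral>x. f x * g x \<partial>lebesgue_on {0..t})"
  proof -
    \<comment> \<open>Integrability is known on the open interval, while the target integral runs
      over \<open>{0..t}\<close>; the endpoint \<open>0\<close> is added as a null set.\<close>
    have "integrable (lebesgue_on {0<..t}) (\<lambda>x. f x * g x)"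
      using fgi by (rule integrable_lebesgue_on_subset) (use t in auto)
    then have "(\<lambda>x. f x * g x) absolutely_integrable_on {0<..t}"
      by (simp add: set_integrable_def integrable_restrict_space)
    then have "(\<lambda>x. f x * g x) absolutely_integrable_on {0..t}"
      by (rule absolutely_integrable_spike_set_eq[THEN iffD1, rotated 2])
        (rule negligible_subset[of "{0}"]; auto)+
    then have "integrable (lebesgue_on {0..t}) (\<lambda>x. f x * g x)"
      by (rule absolutely_integrable_imp_integrable) auto
    then show ?thesis by (simp add: lebesgue_integral_eq_integral)
  qed
  finally show ?thesis using V(3) W(3) by (simp add: g2_def)
qed

lemma deriv_sin_cos_scaled:
  fixes w :: real
  shows "deriv (\<lambda>x. sin (w * x)) = (\<lambda>x. w * cos (w * x))"
    and "deriv (\<lambda>x. cos (w * x)) = (\<lambda>x. - w * sin (w * x))"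
    and "deriv (deriv (\<lambda>x. sin (w * x))) = (\<lambda>x. - w\<^sup>2 * sin (w * x))"
    and "deriv (deriv (\<lambda>x. cos (w * x))) = (\<lambda>x. - w\<^sup>2 * cos (w * x))"
proof -
  show s: "deriv (\<lambda>x. sin (w * x)) = (\<lambda>x. w * cos (w * x))"
    and c: "deriv (\<lambda>x. cos (w * x)) = (\<lambda>x. - w * sin (w * x))"
    by (auto intro!: DERIV_imp_deriv derivative_eq_intros)
  show "deriv (deriv (\<lambda>x. sin (w * x))) = (\<lambda>x. - w\<^sup>2 * sin (w * x))"
    "deriv (deriv (\<lambda>x. cos (w * x))) = (\<lambda>x. - w\<^sup>2 * cos (w * x))"
    unfolding s c
    by (auto intro!: DERIV_imp_deriv derivative_eq_intros simp: power2_eq_square)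
qed

text \<open>At each time an orthogonal matrix with entries \<open>cos (w * t)\<close> and
  \<open>sin (w * t)\<close> up to sign takes \<open>(W t, w * V t)\<close> to
  \<open>c\<^sup>2\<close> times the cosine and sine parts. It preserves the sum of squares, and
  integrating the resulting pointwise identity gives the claim.\<close>

lemma energy_identity:
  fixes f u :: "real \<Rightarrow> real" and c l T :: real
  assumes l: "0 < l" and c: "0 < c"
    and f: "f \<in> L2 {0<..<T}" and u: "u \<in> U_space T" and ode: "solves_ode T c l f u"
  shows "c\<^sup>2 * ((L2_norm {0<..<T} (cos_part (c\<^sup>2 * l) f))\<^sup>2 + (L2_norm {0<..<T} (sin_part (c\<^sup>2 * l) f))\<^sup>2) =
    l * (L2_norm {0<..<T} u)\<^sup>2 + 1 / c\<^sup>2 * (L2_norm {0<..<T} (time_deriv T u))\<^sup>2"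
proof -
  let ?S = "{0<..<T}"
  let ?M = "lebesgue_on ?S"
  define q where "q = time_deriv T u"
  define r where "r = time_deriv T q"
  define w where "w = sqrt (c\<^sup>2 * l)"
  have w2: "w\<^sup>2 = c\<^sup>2 * l" using l by (simp add: w_def)
  have H: "u \<in> H1 ?S" "q \<in> H1 ?S" using u by (auto simp: U_space_def H2_def q_def)
  then have L: "u \<in> L2 ?S" "q \<in> L2 ?S" by (auto simp: H1_def)
  have i: "integrable ?M u" "integrable ?M f"
    using L f by (auto intro: L2_imp_integrable)
  have ode': "AE x in ?M. r x + w\<^sup>2 * u x = c\<^sup>2 * f x"
    using ode c unfolding solves_ode_def r_def q_def w2
    by (auto simp: field_simps elim!: eventually_mono)
  \<comment> \<open>\<open>H1\<close> provides some square integrable weak derivative of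
    \<open>q\<close>, whereas \<open>r\<close> is the chosen one. The equation identifies
    \<open>r\<close> almost everywhere with a combination of \<open>f\<close> and \<open>u\<close>,
    which gives measurability and then integrability.\<close>
  have rm: "r \<in> borel_measurable ?M"
    by (rule borel_measurable_lebesgue_on_AE[of "\<lambda>x. c\<^sup>2 * f x - w\<^sup>2 * u x"])
      (use i ode' in \<open>auto elim!: eventually_mono simp: algebra_simps\<close>)
  have ri: "integrable ?M r"
    by (rule integrable_cong_AE_imp[of _ "\<lambda>x. c\<^sup>2 * f x - w\<^sup>2 * u x"])
      (use i rm ode' in \<open>auto elim!: eventually_mono simp: algebra_simps\<close>)
  obtain V W where V: "continuous_on {0..T} V" "AE x in ?M. V x = u x" "V 0 = 0"
    and W: "continuous_on {0..T} W" "AE x in ?M. W x = q x" "W 0 = 0"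
    using u unfolding U_space_def has_initial_value_def q_def by auto
  note osc = oscillator_wronskian[OF has_weak_partial_time_deriv[OF H(1), folded q_def] i(1)
    has_weak_partial_time_deriv[OF H(2), folded r_def] ri _ ode' V W]
  let ?C = "cos_part (c\<^sup>2 * l) f" and ?D = "sin_part (c\<^sup>2 * l) f"
  have fi: "integrable ?M (\<lambda>x. c\<^sup>2 * f x)" using i by simp
  have cs: "cont_diff n (\<lambda>x. cos (w * x))" "cont_diff n (\<lambda>x. sin (w * x))" for n
    using cont_diff_sin_cos by auto
  \<comment> \<open>The Wronskian identity with right-hand side \<open>c\<^sup>2 * f x\<close>,
    taken for the cosine here and for the sine next.\<close>
  have C: "W t * cos (w * t) + w * V t * sin (w * t) = c\<^sup>2 * ?C t" if "t \<in> ?S" for t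
    using osc[OF fi cs(1) _ that] fun_cong[OF deriv_sin_cos_scaled(4)[of w]]
    by (simp add: deriv_sin_cos_scaled(2) cos_part_def mult.assoc flip: w_def)
      (simp add: mult_ac)
  have D: "W t * sin (w * t) - w * V t * cos (w * t) = c\<^sup>2 * ?D t" if "t \<in> ?S" for t
    using osc[OF fi cs(2) _ that] fun_cong[OF deriv_sin_cos_scaled(3)[of w]]
    by (simp add: deriv_sin_cos_scaled(1) sin_part_def mult.assoc flip: w_def)
      (simp add: mult_ac)
  \<comment> \<open>On the open interval the cosine and sine parts are \<open>1 / c\<^sup>2\<close>
    times functions continuous on the closed one, so their squares are integrable.\<close>
  have sq: "integrable ?M (\<lambda>t. (F t)\<^sup>2)"
    if "continuous_on {0..T} G" "\<And>t. t \<in> ?S \<Longrightarrow> G t = c\<^sup>2 * F t" for F G :: "real \<Rightarrow> real"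
  proof -
    have "integrable (lebesgue_on {0..T}) (\<lambda>t. (G t / c\<^sup>2)\<^sup>2)"
      using c by (intro continuous_imp_integrable_real continuous_intros that(1)) auto
    then have "integrable ?M (\<lambda>t. (G t / c\<^sup>2)\<^sup>2)"
      by (rule integrable_lebesgue_on_subset) auto
    then show ?thesis
      by (rule Bochner_Integration.integrable_cong[THEN iffD1, rotated 2])
        (use that(2) c in auto)
  qed
  have "continuous_on {0..T} (\<lambda>t. W t * cos (w * t) + w * V t * sin (w * t))"
    "continuous_on {0..T} (\<lambda>t. W t * sin (w * t) - w * V t * cos (w * t))"
    by (intro continuous_intros V W)+
  note CD = sq[OF this(1) C] sq[OF this(2) D]
  have uq: "integrable ?M (\<lambda>t. (u t)\<^sup>2)" "integrable ?M (\<lambda>t. (q t)\<^sup>2)"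
    using L by (auto simp: L2_def)
  have id: "c\<^sup>2 * ((?C t)\<^sup>2 + (?D t)\<^sup>2) = l * (V t)\<^sup>2 + 1 / c\<^sup>2 * (W t)\<^sup>2" if "t \<in> ?S" for t
  proof -
    \<comment> \<open>Multiplying by \<open>c\<^sup>2\<close> once more makes the left side a sum of
      squares of the two Wronskians; the factor is cancelled at the end.\<close>
    have "(c\<^sup>2)\<^sup>2 * ((?C t)\<^sup>2 + (?D t)\<^sup>2) = (c\<^sup>2 * ?C t)\<^sup>2 + (c\<^sup>2 * ?D t)\<^sup>2"
      by (simp add: power_mult_distrib distrib_left)
    also have "\<dots> = ((W t)\<^sup>2 + w\<^sup>2 * (V t)\<^sup>2) * ((sin (w * t))\<^sup>2 + (cos (w * t))\<^sup>2)"
      unfolding C[OF that, symmetric] D[OF that, symmetric]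
      by algebra
    finally show ?thesis using c
      unfolding w2 sin_cos_squared_add mult_1_right by (simp add: field_simps power2_eq_square)
  qed
  have "(\<integral>t. c\<^sup>2 * ((?C t)\<^sup>2 + (?D t)\<^sup>2) \<partial>?M) = (\<integral>t. l * (u t)\<^sup>2 + 1 / c\<^sup>2 * (q t)\<^sup>2 \<partial>?M)"
  proof (rule integral_cong_AE)
    have "AE t in ?M. t \<in> ?S" by (rule AE_I2) simp
    with V(2) W(2) show "AE t in ?M. c\<^sup>2 * ((?C t)\<^sup>2 + (?D t)\<^sup>2) = l * (u t)\<^sup>2 + 1 / c\<^sup>2 * (q t)\<^sup>2"
      by eventually_elim (use id in auto)
    show "(\<lambda>t. c\<^sup>2 * ((?C t)\<^sup>2 + (?D t)\<^sup>2)) \<in> borel_measurable ?M" using CD by measurable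
    show "(\<lambda>t. l * (u t)\<^sup>2 + 1 / c\<^sup>2 * (q t)\<^sup>2) \<in> borel_measurable ?M" using uq by measurable
  qed
  then show ?thesis using CD uq by (simp add: L2_norm_power2 q_def)
qed

section \<open>Norm estimates and the equivalence\<close>

text \<open>Rests on \<open>(a + b)\<^sup>2 \<le> 2 * a\<^sup>2 + 2 * b\<^sup>2\<close>. It is
  applied to the equation solved for the second derivative and then for \<open>f\<close>; the
  membership claim makes the second application possible.\<close>

lemma L2_norm_sum_le:
  fixes h k :: "real \<Rightarrow> real"
  assumes "h \<in> L2 S" "k \<in> L2 S" "AE x in lebesgue_on S. g x = \<alpha> * h x + \<beta> * k x"
    and S: "S \<in> sets lebesgue"
  shows "g \<in> L2 S" "(L2_norm S g)\<^sup>2 \<le> 2 * \<alpha>\<^sup>2 * (L2_norm S h)\<^sup>2 + 2 * \<beta>\<^sup>2 * (L2_norm S k)\<^sup>2"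
proof -
  let ?M = "lebesgue_on S"
  let ?B = "\<lambda>x. 2 * \<alpha>\<^sup>2 * (h x)\<^sup>2 + 2 * \<beta>\<^sup>2 * (k x)\<^sup>2"
  have i: "integrable ?M (\<lambda>x. (h x)\<^sup>2)" "integrable ?M (\<lambda>x. (k x)\<^sup>2)"
    and m: "h \<in> borel_measurable ?M" "k \<in> borel_measurable ?M"
    using assms by (auto simp: L2_def)
  have gm: "g \<in> borel_measurable ?M"
    by (rule borel_measurable_lebesgue_on_AE[of "\<lambda>x. \<alpha> * h x + \<beta> * k x"])
      (use m S assms(3) in \<open>auto elim!: eventually_mono\<close>)
  have "(a + b)\<^sup>2 \<le> 2 * a\<^sup>2 + 2 * b\<^sup>2" for a b :: real
    using sum_squares_bound[of a b] by (simp add: power2_sum)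
  then have le: "AE x in ?M. (g x)\<^sup>2 \<le> ?B x"
    using assms(3) by (auto elim!: eventually_mono simp: power_mult_distrib mult.assoc)
      (metis power_mult_distrib)
  have gi: "integrable ?M (\<lambda>x. (g x)\<^sup>2)"
    by (rule Bochner_Integration.integrable_bound[of _ ?B])
      (use le gm i in \<open>auto elim!: eventually_mono\<close>)
  with gm show "g \<in> L2 S" by (simp add: L2_def)
  show "(L2_norm S g)\<^sup>2 \<le> 2 * \<alpha>\<^sup>2 * (L2_norm S h)\<^sup>2 + 2 * \<beta>\<^sup>2 * (L2_norm S k)\<^sup>2"
    using integral_mono_AE[OF gi _ le] i by (simp add: L2_norm_power2)
qed

text \<open>By the energy identity \<open>x\<close> and \<open>y\<close> share the summands in
  \<open>u\<close> and its first derivative. They differ in the scaled norms of the second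
  derivative and of \<open>f\<close>, each at most twice the other plus twice the shared term in
  \<open>u\<close>. That term already occurs once, whence \<open>3 = 1 + 2\<close>.\<close>

lemma U_norm_equivalence:
  fixes f u :: "real \<Rightarrow> real" and c l T :: real
  assumes l: "0 < l" and c: "0 < c"
    and f: "f \<in> L2 {0<..<T}" and u: "u \<in> U_space T" and ode: "solves_ode T c l f u"
  defines "x \<equiv> (U_norm T c l u)\<^sup>2 + 1 / c\<^sup>2 * (L2_norm {0<..<T} (time_deriv T u))\<^sup>2"
    and "y \<equiv> 1 / l * (L2_norm {0<..<T} f)\<^sup>2
              + c\<^sup>2 * ((L2_norm {0<..<T} (cos_part (c\<^sup>2 * l) f))\<^sup>2
                    + (L2_norm {0<..<T} (sin_part (c\<^sup>2 * l) f))\<^sup>2)"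
  shows "x \<le> 3 * y" "y \<le> 3 * x"
proof -
  let ?S = "{0<..<T}"
  define r where "r = time_deriv T (time_deriv T u)"
  define A B Q F where "A = (L2_norm ?S u)\<^sup>2" and "B = (L2_norm ?S r)\<^sup>2"
    and "Q = (L2_norm ?S (time_deriv T u))\<^sup>2" and "F = (L2_norm ?S f)\<^sup>2"
  have nn: "0 \<le> A" "0 \<le> B" "0 \<le> Q" "0 \<le> F" by (auto simp: A_def B_def Q_def F_def)
  have uL: "u \<in> L2 ?S" using u by (auto simp: U_space_def H2_def H1_def)
  have ode1: "AE t in lebesgue_on ?S. r t = c\<^sup>2 * f t + (- (c\<^sup>2 * l)) * u t"
    using ode c unfolding solves_ode_def r_def
    by (auto elim!: eventually_mono simp: field_simps)
  have ode2: "AE t in lebesgue_on ?S. f t = (1 / c\<^sup>2) * r t + l * u t"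
    using ode unfolding solves_ode_def r_def by (auto elim!: eventually_mono)
  have S: "?S \<in> sets lebesgue" by simp
  have "B \<le> 2 * (c\<^sup>2)\<^sup>2 * F + 2 * (- (c\<^sup>2 * l))\<^sup>2 * A"
    unfolding A_def B_def F_def by (rule L2_norm_sum_le(2)[OF f uL ode1 S])
  \<comment> \<open>With this weight all powers of \<open>c\<close> and \<open>l\<close> are
    absorbed into the scaled norms, which is why the constants are independent of them.\<close>
  then have B: "1 / (c ^ 4 * l) * B \<le> 2 * (1 / l * F) + 2 * (l * A)"
    using l c by (simp add: field_simps power2_eq_square power4_eq_xxxx)
  have "F \<le> 2 * (1 / c\<^sup>2)\<^sup>2 * B + 2 * l\<^sup>2 * A"
    unfolding A_def B_def F_def
    by (rule L2_norm_sum_le(2)[OF L2_norm_sum_le(1)[OF f uL ode1 S] uL ode2 S])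
  then have F: "1 / l * F \<le> 2 * (1 / (c ^ 4 * l) * B) + 2 * (l * A)"
    using l c by (simp add: field_simps power2_eq_square power4_eq_xxxx)
  have p: "0 \<le> l * A" "0 \<le> 1 / (c ^ 4 * l) * B" "0 \<le> 1 / c\<^sup>2 * Q" "0 \<le> 1 / l * F"
    using nn l by auto
  have "x = l * A + 1 / (c ^ 4 * l) * B + 1 / c\<^sup>2 * Q"
    using p by (simp add: x_def U_norm_def A_def B_def Q_def r_def)
  moreover have "y = 1 / l * F + (l * A + 1 / c\<^sup>2 * Q)"
    using energy_identity[OF l c f u ode] by (simp add: y_def F_def A_def Q_def)
  ultimately show "x \<le> 3 * y" "y \<le> 3 * x" using B F p by linarith+
qed

theorem proposition4p5:
  "\<exists>C1 C2 :: real. 0 < C1 \<and> C1 \<le> C2 \<and>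
    (\<forall>(\<Omega> :: 'a::euclidean_space set) (lam :: nat \<Rightarrow> real) (k :: nat) (c :: real) (T :: real) f u.
       lipschitz_domain \<Omega> \<longrightarrow> dirichlet_eigenvalues \<Omega> lam \<longrightarrow> 1 \<le> k \<longrightarrow> 0 < c \<longrightarrow> 0 < T \<longrightarrow>
       f \<in> L2 {0<..<T} \<longrightarrow> u \<in> U_space T \<longrightarrow> solves_ode T c (lam k) f u \<longrightarrow>
       (let x = (U_norm T c (lam k) u)\<^sup>2 + 1 / c\<^sup>2 * (L2_norm {0<..<T} (time_deriv T u))\<^sup>2;
            y = 1 / lam k * (L2_norm {0<..<T} f)\<^sup>2
              + c\<^sup>2 * ((L2_norm {0<..<T} (cos_part (c\<^sup>2 * lam k) f))\<^sup>2
                    + (L2_norm {0<..<T} (sin_part (c\<^sup>2 * lam k) f))\<^sup>2)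
        in C1 * x \<le> y \<and> y \<le> C2 * x))"
proof (rule exI[of _ "1/3"], rule exI[of _ 3], intro conjI allI impI)
  fix \<Omega> :: "'a set" and lam k c T f u
  assume "dirichlet_eigenvalues \<Omega> lam" "1 \<le> k" and c: "0 < c"
    and f: "f \<in> L2 {0<..<T}" "u \<in> U_space T" "solves_ode T c (lam k) f u"
  then have "0 < lam 1" "mono_on {1..} lam" unfolding dirichlet_eigenvalues_def by auto
  \<comment> \<open>Positivity passes from the first eigenvalue to all later ones by
    monotonicity.\<close>
  with \<open>1 \<le> k\<close> have "0 < lam k" by (meson atLeast_iff monotone_onD order_less_le_trans order_refl)
  \<comment> \<open>The bound of \<open>x\<close> by \<open>3 * y\<close> is the lower estimate with
    \<open>C1 = 1/3\<close>; the other bound is the upper one with \<open>C2 = 3\<close>.\<close>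
  have "1/3 * x \<le> y \<and> y \<le> 3 * x" if "x \<le> 3 * y" "y \<le> 3 * x" for x y :: real
    using that by simp
  from this[OF U_norm_equivalence[OF \<open>0 < lam k\<close> c f]] show "let x = (U_norm T c (lam k) u)\<^sup>2 + 1 / c\<^sup>2 * (L2_norm {0<..<T} (time_deriv T u))\<^sup>2;
            y = 1 / lam k * (L2_norm {0<..<T} f)\<^sup>2
              + c\<^sup>2 * ((L2_norm {0<..<T} (cos_part (c\<^sup>2 * lam k) f))\<^sup>2
                    + (L2_norm {0<..<T} (sin_part (c\<^sup>2 * lam k) f))\<^sup>2)
        in 1/3 * x \<le> y \<and> y \<le> 3 * x"
    by (simp only: Let_def)
qed auto

end
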